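(* Let $\mathcal{C}$ be a class of functions $X'\to\{-1,1\}$, $D'$ a distribution over $X'$, and $d'=\mathrm{SQDIM}(\mathcal{C},D')$. Let $\mathcal{L}=(\mathcal{C},D',\epsilon)$ be the instance of learning $\mathcal{C}$ over $D'$ with $\epsilon=1/2-1/(2d'^{1/3})$. Then $$\mathrm{SD}(\mathcal{Z}_\mathcal{L},\gamma=1/d',\beta=1)\ge d'-\frac{1}{1/d'^{2/3}-1/d'}.$$
   Context: $\mathrm{SQDIM}(\mathcal{C},D')$ is the largest $d'$ for which there exist $c_1,\dots,c_{d'}\in\mathcal{C}$ with $|\langle c_i,c_j\rangle_{D'}|\le 1/d'$ for all $i\ne j$, where $\langle f,g\rangle_{D'}=\mathbb{E}_{x'\sim D'}[f(x')g(x')]$. The search problem $\mathcal{Z}_\mathcal{L}$: domain $X=X'\times\{-1,1\}$; for $c\in\mathcal{C}$, $D_c$ is the distribution on $X$ with $D_c(x',c(x'))=D'(x')$ and $D_c(x',-c(x'))=0$; the class of distributions is $\mathcal{D}_\mathcal{L}=\{D_c:c\in\mathcal{C}\}$; the solution set $\mathcal{F}_\mathcal{L}$ is the set of all functions $f:X'\to\{-1,1\}$; $f\in\mathcal{Z}_\mathcal{L}(D_c)$ iff $\Pr_{(x',\ell)\sim D_c}[f(x')=\ell]\ge1-\epsilon$; $\mathcal{Z}_\mathcal{L}^{-1}(f)=\{D\in\mathcal{D}_\mathcal{L}:f\in\mathcal{Z}_\mathcal{L}(D)\}$. For distributions $D_1,D$ over $X$ (with $D(x)=0\Rightarrow D_1(x)=0$),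 $\frac{D_1}{D}-1$ denotes $x\mapsto D_1(x)/D(x)-1$ on the support of $D$ and $\langle f,g\rangle_D=\mathbb{E}_{x\sim D}[f(x)g(x)]$. $\mathrm{SD}(\mathcal{Z},\gamma,\beta)$ is the maximum integer $m$ such that there exist a reference distribution $D$ over $X$ and a finite $\mathcal{D}_D\subseteq\mathcal{D}_\mathcal{L}$ such that for every $f\in\mathcal{F}_\mathcal{L}$ there are $m$ distributions $D_1,\dots,D_m\in\mathcal{D}_D\setminus\mathcal{Z}^{-1}(f)$ with $\left|\left\langle\frac{D_i}{D}-1,\frac{D_j}{D}-1\right\rangle_D\right|\le\beta$ if $i=j$ and $\le\gamma$ if $i\ne j$. *)

theory Defs
  imports "HOL-Probability.Probability"
begin

definition inner_dist :: "'a pmf \<Rightarrow> ('a \<Rightarrow> real) \<Rightarrow> ('a \<Rightarrow> real) \<Rightarrow> real" where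
  "inner_dist D f g = measure_pmf.expectation D (\<lambda>x. f x * g x)"

definition sign_functions :: "('a \<Rightarrow> real) set" where
  "sign_functions = {f. \<forall>x. f x \<in> {-1, 1}}"

text \<open>
  ``The largest \<open>d\<close> such that \<dots>'' is a supremum in \<^typ>\<open>enat\<close>: it is the maximum whenever the
  maximum exists, and \<open>\<infinity>\<close> when arbitrarily large \<open>d\<close> are admissible.
\<close>

definition SQDIM :: "('a \<Rightarrow> real) set \<Rightarrow> 'a pmf \<Rightarrow> enat" where
  "SQDIM C D' = Sup {enat d | d. \<exists>c :: nat \<Rightarrow> 'a \<Rightarrow> real.
     (\<forall>i<d. c i \<in> C) \<and>
     (\<forall>i<d. \<forall>j<d. i \<noteq> j \<longrightarrow> \<bar>inner_dist D' (c i) (c j)\<bar> \<le> 1 / real d)}"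

record ('x, 'f) search_problem =
  domain :: "'x set"
  dists :: "'x pmf set"
  solutions :: "'f set"
  valid :: "'x pmf \<Rightarrow> 'f set"

definition valid_inv :: "('x, 'f) search_problem \<Rightarrow> 'f \<Rightarrow> 'x pmf set" where
  "valid_inv Z f = {D \<in> dists Z. f \<in> valid Z D}"

text \<open>Only used on the support of \<open>D\<close>; expectations over \<open>D\<close> ignore all other points.\<close>

definition rel_density :: "'x pmf \<Rightarrow> 'x pmf \<Rightarrow> 'x \<Rightarrow> real" where
  "rel_density D1 D x = pmf D1 x / pmf D x - 1"

text \<open>
  The \<open>m\<close> distributions are distinct. The Bochner integral of a non-integrable function is \<open>0\<close>,
  so integrability is required explicitly; otherwise a divergent correlation would count as small.
\<close>

definition SD :: "('x, 'f) search_problem \<Rightarrow> real \<Rightarrow> real \<Rightarrow> enat" where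
  "SD Z \<gamma> \<beta> = Sup {enat m | m. \<exists>D DD.
     set_pmf D \<subseteq> domain Z \<and> finite DD \<and> DD \<subseteq> dists Z \<and>
     (\<forall>f\<in>solutions Z. \<exists>E :: nat \<Rightarrow> 'x pmf.
        inj_on E {..<m} \<and>
        (\<forall>i<m. E i \<in> DD - valid_inv Z f) \<and>
        (\<forall>i<m. \<forall>x. pmf D x = 0 \<longrightarrow> pmf (E i) x = 0) \<and>
        (\<forall>i<m. \<forall>j<m.
           integrable (measure_pmf D) (\<lambda>x. rel_density (E i) D x * rel_density (E j) D x) \<and>
           \<bar>inner_dist D (rel_density (E i) D) (rel_density (E j) D)\<bar>
             \<le> (if i = j then \<beta> else \<gamma>)))}"

definition labelled_dist :: "'a pmf \<Rightarrow> ('a \<Rightarrow> real) \<Rightarrow> ('a \<times> real) pmf" where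
  "labelled_dist D' c = map_pmf (\<lambda>x. (x, c x)) D'"

lemma pmf_labelled_dist:
  "pmf (labelled_dist D' c) (x, l) = (if l = c x then pmf D' x else 0)"
proof (cases "l = c x")
  case True
  have "inj (\<lambda>x. (x, c x))"
    by (auto intro: injI)
  then show ?thesis
    using True pmf_map_inj'[of "\<lambda>x. (x, c x)" D' x] by (simp add: labelled_dist_def)
next
  case False
  then have "(x, l) \<notin> set_pmf (labelled_dist D' c)"
    by (auto simp: labelled_dist_def)
  then show ?thesis
    using False by (simp add: set_pmf_iff)
qed

definition learning_problem ::
  "('a \<Rightarrow> real) set \<Rightarrow> 'a pmf \<Rightarrow> real \<Rightarrow> ('a \<times> real, 'a \<Rightarrow> real) search_problem" where
  "learning_problem C D' \<epsilon> =
     \<lparr> domain = UNIV \<times> {-1, 1},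
       dists = labelled_dist D' ` C,
       solutions = sign_functions,
       valid = (\<lambda>D. {f \<in> sign_functions.
         measure_pmf.prob D {(x, l). f x = l} \<ge> 1 - \<epsilon>}) \<rparr>"

end

theory Submission
  imports Defs
begin

text \<open>
  Take the product of \<open>D'\<close> with the uniform distribution on labels as the reference distribution.
  Relative to it, the density of \<open>D\<^sub>c\<close> minus one is \<open>(x, l) \<mapsto> l * c x\<close>, so the pairwise
  correlations of the distributions \<open>D\<^sub>c\<close> are exactly those of the functions \<open>c\<close> over \<open>D'\<close>.
  A hypothesis \<open>f\<close> that solves the problem for \<open>D\<^sub>c\<close> has correlation at least \<open>d'\<^sup>-\<^sup>1\<^sup>/\<^sup>3\<close> with \<open>c\<close>,
  and by Cauchy--Schwarz this can happen only for few members of an almost orthogonal family.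
\<close>

section \<open>Correlations of sign functions\<close>

lemma sign_functions_sq: "f \<in> sign_functions \<Longrightarrow> f x * f x = 1"
  unfolding sign_functions_def by (drule CollectD, drule spec[of _ x]) auto

lemma sign_functions_abs: "f \<in> sign_functions \<Longrightarrow> \<bar>f x\<bar> = 1"
  unfolding sign_functions_def by (drule CollectD, drule spec[of _ x]) auto

lemma integrable_sign_mult:
  assumes "f \<in> sign_functions" "g \<in> sign_functions"
  shows "integrable (measure_pmf D) (\<lambda>x. f x * g x)"
  by (rule measure_pmf.integrable_const_bound[where B = 1])
    (simp_all add: abs_mult sign_functions_abs assms)

lemma inner_dist_self_sign: "f \<in> sign_functions \<Longrightarrow> inner_dist D f f = 1"
  by (simp add: inner_dist_def sign_functions_sq)

lemma inner_dist_eq_prob: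
  assumes "f \<in> sign_functions" "g \<in> sign_functions"
  shows "inner_dist D f g = 2 * measure_pmf.prob D {x. f x = g x} - 1"
proof -
  have "f x * g x = 2 * indicator {x. f x = g x} x - 1" for x
  proof -
    have "f x \<in> {-1, 1}" "g x \<in> {-1, 1}"
      using assms by (auto simp: sign_functions_def)
    then show ?thesis by (auto simp: indicator_def)
  qed
  then have "inner_dist D f g
      = measure_pmf.expectation D (\<lambda>x. 2 * indicator {x. f x = g x} x - 1)"
    by (simp add: inner_dist_def)
  also have "\<dots> = 2 * measure_pmf.prob D {x. f x = g x} - 1"
    by (subst Bochner_Integration.integral_diff)
      (auto simp: measure_pmf.prob_space intro!: integrable_real_indicator
        measure_pmf.emeasure_finite[THEN less_top[THEN iffD1]])
  finally show ?thesis .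
qed

section \<open>Counting the functions correlated with a hypothesis\<close>

text \<open>With \<open>n = card A\<close>, expand the nonnegative expectation of the square of
  \<open>(\<Sum>i\<in>A. c i x) - n * \<tau> * f x\<close>. The diagonal contributes
  \<open>n\<close>, the other pairs at most \<open>n\<^sup>2 * \<gamma>\<close>, and the terms with
  \<open>f\<close> at most \<open>- n\<^sup>2 * \<tau>\<^sup>2\<close>.\<close>

lemma card_correlated_bound:
  assumes fin: "finite A"
    and c: "\<And>i. i \<in> A \<Longrightarrow> c i \<in> sign_functions"
    and f: "f \<in> sign_functions"
    and orth: "\<And>i j. \<lbrakk>i \<in> A; j \<in> A; i \<noteq> j\<rbrakk> \<Longrightarrow> inner_dist D (c i) (c j) \<le> \<gamma>"
    and corr: "\<And>i. i \<in> A \<Longrightarrow> \<tau> \<le> inner_dist D f (c i)"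
    and "0 \<le> \<gamma>" "0 \<le> \<tau>"
  shows "real (card A) * (\<tau>\<^sup>2 - \<gamma>) \<le> 1"
proof (cases "A = {}")
  case True
  then show ?thesis by simp
next
  case False
  define n where "n = real (card A)"
  have n: "n > 0"
    using False fin by (simp add: n_def card_gt_0_iff)
  \<comment> \<open>This value minimises \<open>a\<^sup>2 - 2 * a * n * \<tau>\<close>, so it gives
    the strongest inequality.\<close>
  define a where "a = n * \<tau>"
  have int_cc: "integrable (measure_pmf D) (\<lambda>x. c i x * c j x)" if "i \<in> A" "j \<in> A" for i j
    using that c by (intro integrable_sign_mult) auto
  have int_fc: "integrable (measure_pmf D) (\<lambda>x. f x * c i x)" if "i \<in> A" for i
    using that c f by (intro integrable_sign_mult) auto
  have "0 \<le> measure_pmf.expectation D (\<lambda>x. ((\<Sum>i\<in>A. c i x) - a * f x)\<^sup>2)"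
    by simp
  also have "(\<lambda>x. ((\<Sum>i\<in>A. c i x) - a * f x)\<^sup>2)
      = (\<lambda>x. (\<Sum>i\<in>A. \<Sum>j\<in>A. c i x * c j x) - 2 * a * (\<Sum>i\<in>A. f x * c i x) + a\<^sup>2)"
  proof
    fix x
    have "((\<Sum>i\<in>A. c i x) - a * f x)\<^sup>2
        = (\<Sum>i\<in>A. c i x) * (\<Sum>i\<in>A. c i x) - 2 * a * (f x * (\<Sum>i\<in>A. c i x)) + a\<^sup>2 * (f x * f x)"
      by (simp add: power2_eq_square algebra_simps)
    then show "((\<Sum>i\<in>A. c i x) - a * f x)\<^sup>2
        = (\<Sum>i\<in>A. \<Sum>j\<in>A. c i x * c j x) - 2 * a * (\<Sum>i\<in>A. f x * c i x) + a\<^sup>2"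
      by (simp add: sum_product sum_distrib_left[of "f x"] sign_functions_sq[OF f])
  qed
  also have "measure_pmf.expectation D \<dots>
      = (\<Sum>i\<in>A. \<Sum>j\<in>A. inner_dist D (c i) (c j)) - 2 * a * (\<Sum>i\<in>A. inner_dist D f (c i)) + a\<^sup>2"
    using int_cc int_fc by (simp add: inner_dist_def measure_pmf.prob_space)
  finally have sq: "2 * a * (\<Sum>i\<in>A. inner_dist D f (c i))
      \<le> (\<Sum>i\<in>A. \<Sum>j\<in>A. inner_dist D (c i) (c j)) + a\<^sup>2"
    by simp
  have "(\<Sum>i\<in>A. \<tau>) \<le> (\<Sum>i\<in>A. inner_dist D f (c i))"
    by (intro sum_mono corr)
  then have "2 * a * a \<le> 2 * a * (\<Sum>i\<in>A. inner_dist D f (c i))"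
    using n \<open>0 \<le> \<tau>\<close> by (intro mult_left_mono) (simp_all add: a_def n_def)
  with sq have "a\<^sup>2 \<le> (\<Sum>i\<in>A. \<Sum>j\<in>A. inner_dist D (c i) (c j))"
    by (simp add: power2_eq_square)
  \<comment> \<open>Charging \<open>\<gamma>\<close> to the diagonal as well is harmless as
    \<open>0 \<le> \<gamma>\<close>, and it makes the double sum factor through
    \<open>n\<close>.\<close>
  also have "\<dots> \<le> (\<Sum>i\<in>A. \<Sum>j\<in>A. (if i = j then 1 else 0) + \<gamma>)"
    using orth c \<open>0 \<le> \<gamma>\<close> by (intro sum_mono) (auto simp: inner_dist_self_sign)
  also have "\<dots> = n * (1 + n * \<gamma>)"
    using fin by (simp add: sum.distrib n_def)
  finally have "n * (n * \<tau>\<^sup>2) \<le> n * (1 + n * \<gamma>)"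
    by (simp add: a_def power2_eq_square algebra_simps)
  then have "n * \<tau>\<^sup>2 \<le> 1 + n * \<gamma>"
    using n by simp
  then show ?thesis
    by (simp add: n_def algebra_simps)
qed

section \<open>The reference distribution and relative densities\<close>

definition uniform_labels :: "'a pmf \<Rightarrow> ('a \<times> real) pmf" where
  "uniform_labels D' = pair_pmf D' (pmf_of_set {-1, 1})"

lemma set_uniform_labels: "set_pmf (uniform_labels D') = set_pmf D' \<times> {-1, 1}"
  by (simp add: uniform_labels_def)

text \<open>The quotient of probabilities is 2 if \<open>l = c x\<close> and 0 otherwise. Off the
  support it is 0 / 0 = 0, so the formula is claimed on the support only.\<close>

lemma rel_density_labelled_dist:
  assumes "c \<in> sign_functions" "x \<in> set_pmf D'" "l \<in> {-1, 1}"
  shows "rel_density (labelled_dist D' c) (uniform_labels D') (x, l) = l * c x"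
proof -
  have "c x \<in> {-1, 1}"
    using assms(1) by (auto simp: sign_functions_def)
  moreover have "pmf D' x \<noteq> 0"
    using assms(2) by (simp add: set_pmf_iff)
  moreover have "pmf (pmf_of_set {-1, 1 :: real}) l = 1 / 2"
    using assms(3) by (subst pmf_of_set) auto
  ultimately show ?thesis
    using assms(3) sign_functions_sq[OF assms(1), of x]
    by (auto simp: rel_density_def pmf_labelled_dist uniform_labels_def pmf_pair)
qed

text \<open>The labels cancel because \<open>l * l = 1\<close>.\<close>

lemma rel_density_product:
  assumes "c \<in> sign_functions" "e \<in> sign_functions" "p \<in> set_pmf (uniform_labels D')"
  shows "rel_density (labelled_dist D' c) (uniform_labels D') p
      * rel_density (labelled_dist D' e) (uniform_labels D') p = c (fst p) * e (fst p)"
  using assms by (cases p) (auto simp: set_uniform_labels rel_density_labelled_dist)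

lemma integrable_rel_density_product:
  assumes "c \<in> sign_functions" "e \<in> sign_functions"
  shows "integrable (measure_pmf (uniform_labels D'))
    (\<lambda>p. rel_density (labelled_dist D' c) (uniform_labels D') p
       * rel_density (labelled_dist D' e) (uniform_labels D') p)"
proof (rule measure_pmf.integrable_const_bound[where B = 1])
  show "AE p in measure_pmf (uniform_labels D').
      norm (rel_density (labelled_dist D' c) (uniform_labels D') p
        * rel_density (labelled_dist D' e) (uniform_labels D') p) \<le> 1"
    unfolding AE_measure_pmf_iff
  proof
    fix p
    assume "p \<in> set_pmf (uniform_labels D')"
    from rel_density_product[OF assms this]
    show "norm (rel_density (labelled_dist D' c) (uniform_labels D') p
        * rel_density (labelled_dist D' e) (uniform_labels D') p) \<le> 1"
      by (simp only:) (simp add: abs_mult sign_functions_abs assms)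
  qed
qed simp

lemma inner_dist_rel_density:
  assumes "c \<in> sign_functions" "e \<in> sign_functions"
  shows "inner_dist (uniform_labels D') (rel_density (labelled_dist D' c) (uniform_labels D'))
      (rel_density (labelled_dist D' e) (uniform_labels D')) = inner_dist D' c e"
proof -
  have "inner_dist (uniform_labels D') (rel_density (labelled_dist D' c) (uniform_labels D'))
      (rel_density (labelled_dist D' e) (uniform_labels D'))
      = measure_pmf.expectation (uniform_labels D') (\<lambda>p. c (fst p) * e (fst p))"
    unfolding inner_dist_def
    by (intro integral_cong_AE) (auto simp: AE_measure_pmf_iff rel_density_product assms)
  also have "\<dots> = measure_pmf.expectation (map_pmf fst (uniform_labels D')) (\<lambda>x. c x * e x)"
    by (simp add: integral_map_pmf)
  also have "\<dots> = inner_dist D' c e"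
    by (simp add: uniform_labels_def map_fst_pair_pmf inner_dist_def)
  finally show ?thesis .
qed

lemma labelled_dist_absolutely_continuous:
  assumes "c \<in> sign_functions" "pmf (uniform_labels D') p = 0"
  shows "pmf (labelled_dist D' c) p = 0"
proof -
  have "p \<notin> set_pmf D' \<times> {-1, 1}"
    using assms(2) by (simp add: set_pmf_iff flip: set_uniform_labels)
  moreover have "set_pmf (labelled_dist D' c) \<subseteq> set_pmf D' \<times> {-1, 1}"
    using assms(1) by (auto simp: labelled_dist_def sign_functions_def)
  ultimately show ?thesis
    by (auto simp: set_pmf_iff)
qed

text \<open>Equal labelled distributions force \<open>c\<close> and \<open>e\<close> to agree on the
  support of \<open>D'\<close>. Hence functions with correlation below 1 yield distinct
  distributions, as \<open>SD\<close> demands.\<close>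

lemma labelled_dist_eq_imp_inner_dist:
  assumes "c \<in> sign_functions" "labelled_dist D' c = labelled_dist D' e"
  shows "inner_dist D' c e = 1"
proof -
  have "c x = e x" if "x \<in> set_pmf D'" for x
    using that pmf_labelled_dist[of D' c x "c x"] pmf_labelled_dist[of D' e x "c x"] assms(2)
    by (auto simp: set_pmf_iff split: if_splits)
  then have "inner_dist D' c e = inner_dist D' c c"
    unfolding inner_dist_def
    by (intro integral_cong_AE) (auto simp: AE_measure_pmf_iff)
  then show ?thesis
    using assms(1) by (simp add: inner_dist_self_sign)
qed

text \<open>If \<open>f\<close> and \<open>c\<close> agree with probability \<open>p\<close>, their
  correlation is \<open>2 * p - 1\<close>.\<close>

lemma valid_learning_problem_imp_inner_dist:
  assumes "c \<in> sign_functions" "f \<in> valid (learning_problem C D' \<epsilon>) (labelled_dist D' c)"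
  shows "1 - 2 * \<epsilon> \<le> inner_dist D' f c"
proof -
  have f: "f \<in> sign_functions"
    and "1 - \<epsilon> \<le> measure_pmf.prob (labelled_dist D' c) {(x, l). f x = l}"
    using assms(2) by (auto simp: learning_problem_def)
  moreover have "measure_pmf.prob (labelled_dist D' c) {(x, l). f x = l}
      = measure_pmf.prob D' {x. f x = c x}"
    by (simp add: labelled_dist_def vimage_def)
  ultimately show ?thesis
    using inner_dist_eq_prob[OF f assms(1), of D'] by simp
qed

section \<open>Attaining the statistical query dimension\<close>

text \<open>An infinite set of extended naturals has supremum \<open>\<infinity>\<close>. A finite
  supremum of a nonempty set is therefore a maximum.\<close>

lemma enat_Sup_mem:
  fixes A :: "enat set"
  assumes "Sup A = enat n" "A \<noteq> {}"
  shows "enat n \<in> A"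
proof -
  have "finite A"
    using assms by (metis Sup_enat_def enat.distinct(2) infinity_ne_i0)
  then show ?thesis
    using assms Max_in[of A] by (simp add: Sup_enat_def)
qed

lemma SQDIM_attained:
  assumes "SQDIM C D' = enat d"
  obtains c :: "nat \<Rightarrow> 'a \<Rightarrow> real" where "\<And>i. i < d \<Longrightarrow> c i \<in> C"
    and "\<And>i j. \<lbrakk>i < d; j < d; i \<noteq> j\<rbrakk> \<Longrightarrow> \<bar>inner_dist D' (c i) (c j)\<bar> \<le> 1 / real d"
proof -
  have "enat d \<in> {enat d | d. \<exists>c :: nat \<Rightarrow> 'a \<Rightarrow> real. (\<forall>i<d. c i \<in> C) \<and>
     (\<forall>i<d. \<forall>j<d. i \<noteq> j \<longrightarrow> \<bar>inner_dist D' (c i) (c j)\<bar> \<le> 1 / real d)}"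
    \<comment> \<open>The set is nonempty because all conditions are vacuous for
      \<open>d = 0\<close>.\<close>
    using assms unfolding SQDIM_def by (rule enat_Sup_mem) (auto intro: exI[of _ 0])
  then show ?thesis
    using that by auto
qed

section \<open>Lower bounds on the statistical dimension\<close>

text \<open>The family of all \<open>labelled_dist D' (c i)\<close> serves every \<open>f\<close>;
  only the choice of \<open>m\<close> members not solved by \<open>f\<close> varies.
  Self-correlations equal 1, which is why \<open>\<beta>\<close> is 1 here.\<close>

lemma SD_learning_problem_ge:
  fixes c :: "nat \<Rightarrow> 'a \<Rightarrow> real" and d m :: nat
  assumes sign: "\<And>i. i < d \<Longrightarrow> c i \<in> sign_functions"
    and C: "\<And>i. i < d \<Longrightarrow> c i \<in> C"
    and orth: "\<And>i j. \<lbrakk>i < d; j < d; i \<noteq> j\<rbrakk> \<Longrightarrow> \<bar>inner_dist D' (c i) (c j)\<bar> \<le> \<gamma>"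
    and "\<gamma> < 1"
    and m: "\<And>f. f \<in> sign_functions \<Longrightarrow>
      m \<le> card {i. i < d \<and> f \<notin> valid (learning_problem C D' \<epsilon>) (labelled_dist D' (c i))}"
  shows "enat m \<le> SD (learning_problem C D' \<epsilon>) \<gamma> 1"
proof -
  let ?Z = "learning_problem C D' \<epsilon>"
  let ?D = "uniform_labels D'"
  let ?DD = "(\<lambda>i. labelled_dist D' (c i)) ` {..<d}"
  have inj: "inj_on (\<lambda>i. labelled_dist D' (c i)) {..<d}"
  proof (rule inj_onI, rule ccontr)
    fix i j
    assume ij: "i \<in> {..<d}" "j \<in> {..<d}" "labelled_dist D' (c i) = labelled_dist D' (c j)" "i \<noteq> j"
    then show False
      using labelled_dist_eq_imp_inner_dist[of "c i" D' "c j"] sign[of i] orth[of i j] \<open>\<gamma> < 1\<close>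
      by auto
  qed
  have sel: "\<exists>E. inj_on E {..<m} \<and> (\<forall>i<m. E i \<in> ?DD - valid_inv ?Z f) \<and>
        (\<forall>i<m. \<forall>x. pmf ?D x = 0 \<longrightarrow> pmf (E i) x = 0) \<and>
        (\<forall>i<m. \<forall>j<m.
           integrable (measure_pmf ?D) (\<lambda>x. rel_density (E i) ?D x * rel_density (E j) ?D x) \<and>
           \<bar>inner_dist ?D (rel_density (E i) ?D) (rel_density (E j) ?D)\<bar>
             \<le> (if i = j then 1 else \<gamma>))"
    if f: "f \<in> sign_functions" for f
  proof -
    let ?B = "{i. i < d \<and> f \<notin> valid ?Z (labelled_dist D' (c i))}"
    \<comment> \<open>\<open>h\<close> enumerates \<open>m\<close> of the indices on which
      \<open>f\<close> fails.\<close>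
    have "\<exists>h. h ` {..<m} \<subseteq> ?B \<and> inj_on h {..<m}"
      using m[OF f] by (intro card_le_inj) simp_all
    then obtain h where h: "h ` {..<m} \<subseteq> ?B" and inj_h: "inj_on h {..<m}"
      by blast
    have hd: "h i < d" "f \<notin> valid ?Z (labelled_dist D' (c (h i)))" if "i < m" for i
      using h that by auto
    have h_neq: "h i \<noteq> h j" if "i < m" "j < m" "i \<noteq> j" for i j
      using inj_h that by (auto dest: inj_onD)
    define E where "E = (\<lambda>i. labelled_dist D' (c (h i)))"
    have "inj_on E {..<m}"
      using inj_h hd h_neq inj by (auto simp: E_def inj_on_def)
    then show ?thesis
      using hd h_neq sign orth
      by (intro exI[of _ E])
        (auto simp: E_def valid_inv_def labelled_dist_absolutely_continuous
          integrable_rel_density_product inner_dist_rel_density inner_dist_self_sign)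
  qed
  have "set_pmf ?D \<subseteq> domain ?Z"
    by (auto simp: set_uniform_labels learning_problem_def)
  moreover have "?DD \<subseteq> dists ?Z"
    using C by (auto simp: learning_problem_def)
  moreover have "solutions ?Z = sign_functions"
    by (simp add: learning_problem_def)
  ultimately show ?thesis
    unfolding SD_def using sel
    by (intro Sup_upper CollectI exI[of _ m] conjI refl exI[of _ ?D] exI[of _ ?DD]) auto
qed

theorem theoremB3:
  fixes C :: "('a \<Rightarrow> real) set" and D' :: "'a pmf" and d' :: nat and \<epsilon> :: real
  assumes "C \<subseteq> sign_functions"
    and "SQDIM C D' = enat d'"
    and "\<epsilon> = 1/2 - 1 / (2 * real d' powr (1/3))"
  shows "ereal_of_enat (SD (learning_problem C D' \<epsilon>) (1 / real d') 1)
    \<ge> ereal (real d') - 1 / ereal (1 / real d' powr (2/3) - 1 / real d')"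
proof (cases "d' \<le> 1")
  case True
  \<comment> \<open>The denominator vanishes, and \<open>1 / 0 = \<infinity>\<close> in the extended reals.\<close>
  then have "1 / real d' powr (2/3) - 1 / real d' = 0"
    by (cases "d' = 0") (auto simp: le_Suc_eq)
  then show ?thesis
    by (simp add: divide_ereal_def)
next
  case False
  then have d: "1 < real d'"
    by simp
  define \<tau> where "\<tau> = 1 / real d' powr (1/3)"
  define \<delta> where "\<delta> = 1 / real d' powr (2/3) - 1 / real d'"
  \<comment> \<open>The least natural number above the real bound; \<open>nat\<close> turns a
    negative bound into 0.\<close>
  define m where "m = nat \<lceil>real d' - 1 / \<delta>\<rceil>"
  have "real d' powr (2/3) < real d' powr 1"
    using d by (intro powr_less_mono) auto
  then have \<delta>: "\<delta> > 0"
    using d by (simp add: \<delta>_def frac_less2)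
  \<comment> \<open>The choice of \<open>\<epsilon>\<close> makes \<open>\<tau>\<close> the
    correlation forced by a valid hypothesis, and \<open>\<delta>\<close> is then the factor in
    \<open>card_correlated_bound\<close> for \<open>\<gamma> = 1 / d'\<close>.\<close>
  have \<tau>: "\<tau> \<ge> 0" "\<tau>\<^sup>2 - 1 / real d' = \<delta>"
    by (simp_all add: \<tau>_def \<delta>_def power_divide power2_eq_square flip: powr_add)
  have \<epsilon>: "1 - 2 * \<epsilon> = \<tau>"
    by (simp add: assms(3) \<tau>_def)
  obtain c where c: "\<And>i. i < d' \<Longrightarrow> c i \<in> C"
    and orth: "\<And>i j. \<lbrakk>i < d'; j < d'; i \<noteq> j\<rbrakk> \<Longrightarrow> \<bar>inner_dist D' (c i) (c j)\<bar> \<le> 1 / real d'"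
    using SQDIM_attained[OF assms(2)] by blast
  have sign: "c i \<in> sign_functions" if "i < d'" for i
    using c[OF that] assms(1) by auto
  have "enat m \<le> SD (learning_problem C D' \<epsilon>) (1 / real d') 1"
  proof (rule SD_learning_problem_ge[OF sign c orth])
    fix f :: "'a \<Rightarrow> real"
    assume f: "f \<in> sign_functions"
    let ?V = "\<lambda>i. f \<in> valid (learning_problem C D' \<epsilon>) (labelled_dist D' (c i))"
    have "real (card {i. i < d' \<and> ?V i}) * (\<tau>\<^sup>2 - 1 / real d') \<le> 1"
    proof (rule card_correlated_bound[OF _ _ f])
      show "inner_dist D' (c i) (c j) \<le> 1 / real d'"
        if "i \<in> {i. i < d' \<and> ?V i}" "j \<in> {i. i < d' \<and> ?V i}" "i \<noteq> j" for i j
        using that orth[of i j] by auto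
      show "\<tau> \<le> inner_dist D' f (c i)" if "i \<in> {i. i < d' \<and> ?V i}" for i
        using that valid_learning_problem_imp_inner_dist[OF sign[of i], of f C D' \<epsilon>] \<epsilon> by simp
    qed (use sign \<tau> in auto)
    \<comment> \<open>Dividing by \<open>\<delta> > 0\<close>: \<open>f\<close> solves at most
      \<open>1 / \<delta>\<close> of the \<open>d'\<close> instances and fails on the rest.\<close>
    then have "real (card {i. i < d' \<and> ?V i}) \<le> 1 / \<delta>"
      using \<delta> by (simp add: \<tau> field_simps)
    moreover have "card {i. i < d' \<and> ?V i} + card {i. i < d' \<and> \<not> ?V i} = d'"
    proof -
      have "card {i. i < d' \<and> ?V i} + card {i. i < d' \<and> \<not> ?V i}
          = card ({i. i < d' \<and> ?V i} \<union> {i. i < d' \<and> \<not> ?V i})"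
        by (rule card_Un_disjoint[symmetric]) auto
      also have "{i. i < d' \<and> ?V i} \<union> {i. i < d' \<and> \<not> ?V i} = {..<d'}"
        by auto
      finally show ?thesis by simp
    qed
    ultimately have "real d' - 1 / \<delta> \<le> real (card {i. i < d' \<and> \<not> ?V i})"
      by linarith
    then show "m \<le> card {i. i < d' \<and> \<not> ?V i}"
      unfolding m_def by linarith
  qed (use d in auto)
  then have "ereal_of_enat (enat m)
      \<le> ereal_of_enat (SD (learning_problem C D' \<epsilon>) (1 / real d') 1)"
    by (simp only: ereal_of_enat_le_iff)
  moreover have "ereal (real d') - 1 / ereal \<delta> \<le> ereal_of_enat (enat m)"
  proof -
    have "real d' - 1 / \<delta> \<le> real m"
      unfolding m_def by linarith
    moreover have "1 / ereal \<delta> = ereal (1 / \<delta>)"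
      using \<delta> by (simp add: one_ereal_def)
    ultimately show ?thesis by simp
  qed
  ultimately show ?thesis
    unfolding \<delta>_def by (rule order_trans[rotated])
qed

end
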